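(* Let $\mathbb{P}$ be the space of polynomials in one variable with complex coefficients and let $T:\mathbb{P}\to\mathbb{P}$ be a linear operator with $\deg(T(p))=\deg(p)-1$ for every polynomial $p$ (so $T$ annihilates constants). Let $(r_n)_{n\ge 0}$ be a sequence of polynomials with $r_0=1$, $\deg r_n=n$, and $T(r_n)=r_{n-1}$ for $n\ge 1$. Let $(s_n)_{n\ge0}$ be defined recursively by $s_0=1$ and $\sum_{j=0}^n s_j(x)r_{n-j}(x)=0$ for $n\ge 1$. Let $\mu$ be a measure and let $(p_n)_{n\ge 0}$ be a sequence of orthogonal polynomials with respect to $\mu$. Let $(\psi_i)_{i\ge0}$ be a sequence of polynomials with $\deg\psi_i=i$, put $\mu_j^i=\int r_j\overline{\psi_i}\,d\mu$ for $i,j\ge 0$, and define $$q_n^i(x)=\sum_{j=0}^n\mu_j^i\,s_{n-j}(x),\qquad n,i\ge 0.$$ Then for all integers $n,m\ge 1$, $$\Omega_{m-1}\det\left(T^{i-1}(p_{m+j-1})(x)\right)_{i,j=1}^n=C_{n,m}\det\left(q^{j-1}_{n+i-1}(x)\right)_{i,j=1}^m,$$ where $\Omega_{m-1}$ and $C_{n,m}$ do not depend on $x$ and are given by $$\Omega_{m-1}=\det\left(\mu_{m-i}^{j-1}\right)_{i,j=1}^{m},\qquad C_{n,m}=(-1)^{mn+\binom{m}{2}}\prod_{j=0}^{n-1}\frac{\xi_{m+j}}{\sigma_{m+j}},$$ with $\xi_n$ and $\sigma_n$ the coefficients of $x^n$ in $p_n$ and $r_n$, respectively.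
   Context: Measures are (possibly signed) measures on the real line with finite moments of all orders. A sequence $(p_n)_{n\ge0}$ is a sequence of orthogonal polynomials with respect to $\mu$ if $\deg p_n=n$ for all $n$ and $\int p_n\overline{p_j}\,d\mu=0$ for $0\le j<n$. $T^k$ denotes the $k$-fold composition of $T$ ($T^0$ is the identity). *)

theory Defs
  imports
    "HOL-Analysis.Bochner_Integration"
    "HOL-Computational_Algebra.Polynomial"
    "Jordan_Normal_Form.Determinant"
begin

text \<open>
  A signed measure on the real line is a countably additive real-valued function on the Borel
  sets (values outside the Borel sets are irrelevant). Infinite values need not be considered:
  a measure whose zeroth moment is finite has finite total variation.
\<close>

definition signed_measure :: "(real set \<Rightarrow> real) \<Rightarrow> bool" where
  "signed_measure \<mu> \<longleftrightarrow>
     \<mu> {} = 0 \<and>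
     (\<forall>A :: nat \<Rightarrow> real set. range A \<subseteq> sets borel \<longrightarrow> disjoint_family A \<longrightarrow>
        (\<lambda>k. \<mu> (A k)) sums \<mu> (\<Union>k. A k))"

text \<open>
  Positive and negative variation (Jordan decomposition). The coercion \<open>ennreal\<close> sends negative
  numbers to 0, which does not affect the supremum because \<open>B = {}\<close> contributes 0 anyway.
\<close>

definition pos_variation :: "(real set \<Rightarrow> real) \<Rightarrow> real measure" where
  "pos_variation \<mu> =
     measure_of UNIV (sets borel) (\<lambda>A. SUP B\<in>{B \<in> sets borel. B \<subseteq> A}. ennreal (\<mu> B))"

definition neg_variation :: "(real set \<Rightarrow> real) \<Rightarrow> real measure" where
  "neg_variation \<mu> = pos_variation (\<lambda>A. - \<mu> A)"

definition finite_moments :: "(real set \<Rightarrow> real) \<Rightarrow> bool" where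
  "finite_moments \<mu> \<longleftrightarrow>
     (\<forall>k. integrable (pos_variation \<mu>) (\<lambda>t. t ^ k) \<and> integrable (neg_variation \<mu>) (\<lambda>t. t ^ k))"

definition signed_integral :: "(real set \<Rightarrow> real) \<Rightarrow> (real \<Rightarrow> complex) \<Rightarrow> complex" where
  "signed_integral \<mu> f =
     integral\<^sup>L (pos_variation \<mu>) f - integral\<^sup>L (neg_variation \<mu>) f"

text \<open>The sesquilinear pairing \<open>\<integral> p \<cdot> cnj q d\<mu>\<close> over the real line.\<close>

definition poly_pairing :: "(real set \<Rightarrow> real) \<Rightarrow> complex poly \<Rightarrow> complex poly \<Rightarrow> complex" where
  "poly_pairing \<mu> p q =
     signed_integral \<mu> (\<lambda>t. poly p (complex_of_real t) * cnj (poly q (complex_of_real t)))"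

text \<open>
  The library sets \<open>degree 0 = 0\<close>, so \<open>degree (P n) = n\<close> alone would allow \<open>P 0 = 0\<close>.
\<close>

definition poly_sequence :: "(nat \<Rightarrow> complex poly) \<Rightarrow> bool" where
  "poly_sequence P \<longleftrightarrow> (\<forall>n. P n \<noteq> 0 \<and> degree (P n) = n)"

definition orthogonal_polys :: "(real set \<Rightarrow> real) \<Rightarrow> (nat \<Rightarrow> complex poly) \<Rightarrow> bool" where
  "orthogonal_polys \<mu> p \<longleftrightarrow>
     poly_sequence p \<and> (\<forall>n. \<forall>j<n. poly_pairing \<mu> (p n) (p j) = 0)"

text \<open>
  \<open>deg (T p) = deg p - 1\<close> for all \<open>p\<close>, without the truncation of subtraction on \<open>nat\<close>: constants
  are annihilated, and \<open>T p\<close> is a nonzero constant when \<open>p\<close> has degree 1.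
\<close>

definition lowers_degree_by_one :: "(complex poly \<Rightarrow> complex poly) \<Rightarrow> bool" where
  "lowers_degree_by_one T \<longleftrightarrow>
     (\<forall>p. (degree p = 0 \<longrightarrow> T p = 0) \<and>
          (degree p \<ge> 1 \<longrightarrow> T p \<noteq> 0 \<and> degree (T p) = degree p - 1))"

text \<open>\<open>mixed_moment \<mu> r \<psi> i j\<close> is \<open>\<mu>\<^sub>j\<^sup>i\<close>, and \<open>q_poly \<mu> r \<psi> s n i\<close> is \<open>q\<^sub>n\<^sup>i\<close>.\<close>

definition mixed_moment ::
  "(real set \<Rightarrow> real) \<Rightarrow> (nat \<Rightarrow> complex poly) \<Rightarrow> (nat \<Rightarrow> complex poly) \<Rightarrow> nat \<Rightarrow> nat \<Rightarrow> complex" where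
  "mixed_moment \<mu> r \<psi> i j = poly_pairing \<mu> (r j) (\<psi> i)"

definition q_poly ::
  "(real set \<Rightarrow> real) \<Rightarrow> (nat \<Rightarrow> complex poly) \<Rightarrow> (nat \<Rightarrow> complex poly) \<Rightarrow> (nat \<Rightarrow> complex poly)
     \<Rightarrow> nat \<Rightarrow> nat \<Rightarrow> complex poly" where
  "q_poly \<mu> r \<psi> s n i = (\<Sum>j\<le>n. smult (mixed_moment \<mu> r \<psi> i j) (s (n - j)))"

text \<open>Matrices are indexed from 0, so the 1-based indices \<open>i, j\<close> become \<open>i + 1, j + 1\<close>.\<close>

definition Omega_const ::
  "(real set \<Rightarrow> real) \<Rightarrow> (nat \<Rightarrow> complex poly) \<Rightarrow> (nat \<Rightarrow> complex poly) \<Rightarrow> nat \<Rightarrow> complex" where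
  \<comment> \<open>the argument \<open>m\<close> gives \<open>\<Omega>\<^sub>m\<^sub>-\<^sub>1\<close>\<close>
  "Omega_const \<mu> r \<psi> m = det (mat m m (\<lambda>(i, j). mixed_moment \<mu> r \<psi> j (m - (i + 1))))"

definition C_const :: "(nat \<Rightarrow> complex poly) \<Rightarrow> (nat \<Rightarrow> complex poly) \<Rightarrow> nat \<Rightarrow> nat \<Rightarrow> complex" where
  "C_const p r n m =
     (-1) ^ (m * n + (m choose 2)) *
     (\<Prod>j<n. coeff (p (m + j)) (m + j) / coeff (r (m + j)) (m + j))"

text \<open>
  The definitions above have the expected meaning: for a signed measure with finite moments the
  variations are measures with \<open>\<mu> = \<mu>\<^sup>+ - \<mu>\<^sup>-\<close>, and for a finite positive measure the signed
  integral is the Lebesgue integral.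
\<close>

lemma space_pos_variation [simp]: "space (pos_variation \<mu>) = UNIV"
  by (simp add: pos_variation_def)

lemma sets_pos_variation [simp]: "sets (pos_variation \<mu>) = sets borel"
  using sets.sets_measure_of_eq[of "borel :: real measure"] by (simp add: pos_variation_def)

lemma sets_neg_variation [simp]: "sets (neg_variation \<mu>) = sets borel"
  by (simp add: neg_variation_def)

lemma signed_measure_Un:
  assumes "signed_measure \<mu>" "A \<in> sets borel" "B \<in> sets borel" "A \<inter> B = {}"
  shows "\<mu> (A \<union> B) = \<mu> A + \<mu> B"
proof -
  have "(\<lambda>k. \<mu> (binaryset A B k)) sums \<mu> (\<Union>k. binaryset A B k)"
  proof -
    have "range (binaryset A B) \<subseteq> sets borel"
      using assms(2,3) by (simp add: range_binaryset_eq)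
    moreover have "disjoint_family (binaryset A B)"
      using assms(4) by (auto simp: disjoint_family_on_def binaryset_def)
    ultimately show ?thesis
      using assms(1) unfolding signed_measure_def by blast
  qed
  moreover have "(\<lambda>k. \<mu> (binaryset A B k)) sums (\<mu> A + \<mu> B)"
    using assms(1) by (intro binaryset_sums) (simp add: signed_measure_def)
  ultimately show ?thesis
    by (simp add: UN_binaryset_eq sums_unique2)
qed

lemma signed_measure_uminus: "signed_measure \<mu> \<Longrightarrow> signed_measure (\<lambda>A. - \<mu> A)"
  by (auto simp: signed_measure_def intro: sums_minus)

lemma emeasure_pos_variation:
  assumes \<mu>: "signed_measure \<mu>" and A: "A \<in> sets borel"
  shows "emeasure (pos_variation \<mu>) A = (SUP B\<in>{B \<in> sets borel. B \<subseteq> A}. ennreal (\<mu> B))"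
proof -
  define v where "v = (\<lambda>A. SUP B\<in>{B \<in> sets borel. B \<subseteq> A}. ennreal (\<mu> B))"
  have \<mu>0: "\<mu> {} = 0" using \<mu> by (simp add: signed_measure_def)
  have v_eq: "v A = (SUP B\<in>{B \<in> sets borel. B \<subseteq> A}. ennreal (\<mu> B))" for A
    by (simp add: v_def)
  have v_upper: "ennreal (\<mu> B) \<le> v A" if "B \<in> sets borel" "B \<subseteq> A" for A B
    unfolding v_def using that by (intro SUP_upper) auto
  have v0: "v {} = 0"
  proof -
    have "{B \<in> sets borel. B \<subseteq> ({} :: real set)} = {{}}" by auto
    then show ?thesis by (simp add: v_def \<mu>0)
  qed
  have v_Un: "v A + v B \<le> v (A \<union> B)"
    if AB: "A \<in> sets borel" "B \<in> sets borel" "A \<inter> B = {}" for A B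
  proof -
    have "v A + v B = (SUP C\<in>{C \<in> sets borel. C \<subseteq> A}. ennreal (\<mu> C) + v B)"
      unfolding v_eq[of A] by (subst ennreal_SUP_add_left) auto
    also have "\<dots> \<le> v (A \<union> B)"
    proof (rule SUP_least)
      fix C assume C: "C \<in> {C \<in> sets borel. C \<subseteq> A}"
      have "ennreal (\<mu> C) + v B = (SUP D\<in>{D \<in> sets borel. D \<subseteq> B}. ennreal (\<mu> C) + ennreal (\<mu> D))"
        unfolding v_eq[of B] by (subst ennreal_SUP_add_right) auto
      also have "\<dots> \<le> v (A \<union> B)"
      proof (rule SUP_least)
        fix D assume D: "D \<in> {D \<in> sets borel. D \<subseteq> B}"
        have CD: "\<mu> (C \<union> D) = \<mu> C + \<mu> D"
          using C D AB by (intro signed_measure_Un[OF \<mu>]) auto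
        consider "\<mu> C \<ge> 0" "\<mu> D \<ge> 0" | "\<mu> C < 0" | "\<mu> D < 0" by linarith
        then show "ennreal (\<mu> C) + ennreal (\<mu> D) \<le> v (A \<union> B)"
        proof cases
          case 1
          then have "ennreal (\<mu> C) + ennreal (\<mu> D) = ennreal (\<mu> (C \<union> D))"
            by (simp add: CD ennreal_plus)
          then show ?thesis using C D by (auto intro!: v_upper)
        next
          case 2
          then show ?thesis using D by (auto simp: ennreal_neg intro!: v_upper)
        next
          case 3
          then show ?thesis using C by (auto simp: ennreal_neg intro!: v_upper)
        qed
      qed
      finally show "ennreal (\<mu> C) + v B \<le> v (A \<union> B)" .
    qed
    finally show ?thesis .
  qed
  have v_mono: "v A \<le> v B" if "A \<subseteq> B" for A B
    unfolding v_def using that by (intro SUP_subset_mono) auto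
  have ca: "countably_additive (sets borel) v"
    unfolding countably_additive_def
  proof (intro allI impI)
    fix F :: "nat \<Rightarrow> real set"
    assume F: "range F \<subseteq> sets borel" "disjoint_family F" "(\<Union>i. F i) \<in> sets borel"
    show "(\<Sum>i. v (F i)) = v (\<Union>i. F i)"
    proof (rule antisym)
      have "(\<Sum>i<n. v (F i)) \<le> v (\<Union>i<n. F i)" for n
      proof (induction n)
        case 0 then show ?case by simp
      next
        case (Suc n)
        have "(\<Sum>i<Suc n. v (F i)) \<le> v (\<Union>i<n. F i) + v (F n)"
          using Suc by (simp add: add_right_mono)
        also have "\<dots> \<le> v ((\<Union>i<n. F i) \<union> F n)"
        proof (rule v_Un)
          show "(\<Union>i<n. F i) \<in> sets borel" "F n \<in> sets borel" using F(1) by auto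
          have "F i \<inter> F n = {}" if "i < n" for i
            using F(2) that by (simp add: disjoint_family_on_def)
          then show "(\<Union>i<n. F i) \<inter> F n = {}" by auto
        qed
        also have "(\<Union>i<n. F i) \<union> F n = (\<Union>i<Suc n. F i)"
          by (auto simp: lessThan_Suc)
        finally show ?case .
      qed
      also have "v (\<Union>i<n. F i) \<le> v (\<Union>i. F i)" for n by (rule v_mono) auto
      finally show "(\<Sum>i. v (F i)) \<le> v (\<Union>i. F i)"
        by (intro suminf_le_const summableI)
    next
      show "v (\<Union>i. F i) \<le> (\<Sum>i. v (F i))"
        unfolding v_eq[of "\<Union>i. F i"]
      proof (rule SUP_least)
        fix B assume B: "B \<in> {B \<in> sets borel. B \<subseteq> (\<Union>i. F i)}"
        have UB: "(\<Union>i. B \<inter> F i) = B" using B by auto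
        have "(\<lambda>k. \<mu> (B \<inter> F k)) sums \<mu> (\<Union>k. B \<inter> F k)"
        proof -
          have "range (\<lambda>k. B \<inter> F k) \<subseteq> sets borel" using B F by auto
          moreover have "disjoint_family (\<lambda>k. B \<inter> F k)"
            using F(2) by (auto simp: disjoint_family_on_def)
          ultimately show ?thesis using \<mu> unfolding signed_measure_def by blast
        qed
        then have lim: "(\<lambda>n. \<Sum>k<n. \<mu> (B \<inter> F k)) \<longlonglongrightarrow> \<mu> B"
          by (simp only: UB sums_def)
        have "ennreal (\<Sum>k<n. \<mu> (B \<inter> F k)) \<le> (\<Sum>i. v (F i))" for n
        proof -
          have "ennreal (\<Sum>k<n. \<mu> (B \<inter> F k)) \<le> ennreal (\<Sum>k<n. max 0 (\<mu> (B \<inter> F k)))"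
            by (intro ennreal_leI sum_mono) auto
          also have "\<dots> = (\<Sum>k<n. ennreal (max 0 (\<mu> (B \<inter> F k))))"
            by (subst sum_ennreal) auto
          also have "\<dots> \<le> (\<Sum>k<n. v (F k))"
            using B F by (intro sum_mono) (auto simp: max_def ennreal_neg intro!: v_upper)
          also have "\<dots> \<le> (\<Sum>i. v (F i))" by (rule sum_le_suminf) auto
          finally show ?thesis .
        qed
        then show "ennreal (\<mu> B) \<le> (\<Sum>i. v (F i))"
          by (intro LIMSEQ_le_const2[OF tendsto_ennrealI[OF lim]]) auto
      qed
    qed
  qed
  have "emeasure (pos_variation \<mu>) A = v A"
  proof (rule emeasure_measure_of)
    show "pos_variation \<mu> = measure_of UNIV (sets borel) v"
      by (simp add: pos_variation_def v_def)
    show "positive (sets (pos_variation \<mu>)) v" by (simp add: positive_def v0)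
    show "countably_additive (sets (pos_variation \<mu>)) v" using ca by simp
  qed (use A in auto)
  then show ?thesis by (simp add: v_def)
qed

lemma jordan_decomposition:
  assumes \<mu>: "signed_measure \<mu>" and fin: "finite_moments \<mu>" and A: "A \<in> sets borel"
  shows "\<mu> A = measure (pos_variation \<mu>) A - measure (neg_variation \<mu>) A"
proof -
  have mono: "\<mu> B \<le> \<mu> A + measure (neg_variation \<mu>) A"
    if \<mu>: "signed_measure \<mu>" and fin: "finite_measure (neg_variation \<mu>)"
      and "B \<in> sets borel" "B \<subseteq> A" "A \<in> sets borel" for \<mu> A B
  proof -
    have "\<mu> (B \<union> (A - B)) = \<mu> B + \<mu> (A - B)"
      using that by (intro signed_measure_Un[OF \<mu>]) auto
    moreover have "B \<union> (A - B) = A" using that by auto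
    moreover have "ennreal (- \<mu> (A - B)) \<le> emeasure (neg_variation \<mu>) A"
      unfolding neg_variation_def
      using that by (subst emeasure_pos_variation) (auto intro!: signed_measure_uminus SUP_upper)
    then have "- \<mu> (A - B) \<le> measure (neg_variation \<mu>) A"
      by (simp add: finite_measure.emeasure_eq_measure[OF fin] ennreal_le_iff)
    ultimately show ?thesis by simp
  qed
  have le: "measure (pos_variation \<mu>) A \<le> \<mu> A + measure (neg_variation \<mu>) A"
    if \<mu>: "signed_measure \<mu>" and finp: "finite_measure (pos_variation \<mu>)"
      and finn: "finite_measure (neg_variation \<mu>)" and A: "A \<in> sets borel" for \<mu> A
  proof -
    have "emeasure (pos_variation \<mu>) A \<le> ennreal (\<mu> A + measure (neg_variation \<mu>) A)"
      unfolding emeasure_pos_variation[OF \<mu> A]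
      using mono[OF \<mu> finn _ _ A] by (intro SUP_least ennreal_leI) auto
    moreover have "0 \<le> \<mu> A + measure (neg_variation \<mu>) A"
      using mono[OF \<mu> finn, of "{}" A] \<mu> A by (simp add: signed_measure_def)
    ultimately show ?thesis
      by (simp add: finite_measure.emeasure_eq_measure[OF finp] ennreal_le_iff)
  qed
  have fm: "finite_measure M" if "integrable M (\<lambda>t :: real. t ^ (0::nat) :: real)" for M
    using that by (auto simp: integrable_iff_bounded intro!: finite_measureI)
  have finp: "finite_measure (pos_variation \<mu>)" and finn: "finite_measure (neg_variation \<mu>)"
    using fin fm unfolding finite_moments_def by blast+
  have nn: "neg_variation (\<lambda>A. - \<mu> A) = pos_variation \<mu>" by (simp add: neg_variation_def)
  have "measure (neg_variation \<mu>) A \<le> - \<mu> A + measure (pos_variation \<mu>) A"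
    using le[of "\<lambda>A. - \<mu> A" A] signed_measure_uminus[OF \<mu>] finp finn A
    by (simp add: nn) (simp add: neg_variation_def)
  with le[OF \<mu> finp finn A] show ?thesis by simp
qed

lemma signed_integral_measure:
  assumes M: "finite_measure M" and sets: "sets M = sets borel"
  shows "signed_measure (measure M)" and "signed_integral (measure M) f = integral\<^sup>L M f"
proof -
  interpret finite_measure M by fact
  show sm: "signed_measure (measure M)"
    using sets by (auto simp: signed_measure_def intro!: finite_measure_UNION)
  have "pos_variation (measure M) = M"
  proof (rule measure_eqI)
    fix A assume "A \<in> sets (pos_variation (measure M))"
    then have A: "A \<in> sets borel" by simp
    have "(SUP B\<in>{B \<in> sets borel. B \<subseteq> A}. emeasure M B) = emeasure M A"
      using A sets by (intro antisym SUP_least SUP_upper emeasure_mono) auto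
    then show "emeasure (pos_variation (measure M)) A = emeasure M A"
      by (simp add: emeasure_pos_variation[OF sm A] emeasure_eq_measure)
  qed (simp add: sets)
  moreover have "neg_variation (measure M) = null_measure borel"
  proof (rule measure_eqI)
    fix A assume "A \<in> sets (neg_variation (measure M))"
    then show "emeasure (neg_variation (measure M)) A = emeasure (null_measure borel) A"
      unfolding neg_variation_def
      by (subst emeasure_pos_variation)
        (auto intro!: signed_measure_uminus sm SUP_eq_const simp: ennreal_neg)
  qed simp
  ultimately show "signed_integral (measure M) f = integral\<^sup>L M f"
    by (simp add: signed_integral_def)
qed

text \<open>Linearity of an operator on polynomials is \<open>Vector_Spaces.linear smult smult\<close>.\<close>

lemma vector_space_smult: "vector_space (smult :: complex \<Rightarrow> complex poly \<Rightarrow> complex poly)"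
  by unfold_locales (simp_all add: smult_add_left smult_add_right)

end

theory Submission
  imports Defs
begin

text \<open>
  Put \<open>N = m + n\<close> and expand \<open>p\<^sub>m\<^sub>+\<^sub>i = (\<Sum>l<N. a i l \<cdot> r\<^sub>l)\<close> for \<open>i < n\<close>. The lower triangular
  Toeplitz matrix \<open>R = (r\<^sub>l\<^sub>-\<^sub>j(x))\<close> of size \<open>N\<close> has inverse \<open>S = (s\<^sub>l\<^sub>-\<^sub>j(x))\<close>. Let \<open>M = (\<mu>\<^sub>l\<^sup>j)\<close> be the
  \<open>N \<times> m\<close> matrix of moments, let \<open>Y\<close> consist of the columns of \<open>M\<close> followed by the first \<open>n\<close>
  columns of \<open>R\<close>, and let \<open>X\<close> consist of the first \<open>m\<close> rows of the identity followed by the rows of \<open>a\<close>.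
  Orthogonality says \<open>a M = 0\<close>, so \<open>X Y\<close> is block triangular with diagonal blocks the top of \<open>M\<close>
  and the (transposed) matrix of the \<open>T\<^sup>i p\<^sub>m\<^sub>+\<^sub>j(x)\<close>. On the other hand \<open>X\<close> is triangular, and
  \<open>S Y\<close> is, up to exchanging blocks of columns, block triangular with diagonal blocks the
  identity and the matrix of the \<open>q\<close>s, while \<open>det S = 1\<close>. Comparing determinants gives the claim.
\<close>

section \<open>Integrability of polynomials and sesquilinearity of the pairing\<close>

lemma integrable_poly_of_real:
  assumes "\<And>k. integrable M (\<lambda>t :: real. t ^ k)"
  shows "integrable M (\<lambda>t. poly f (complex_of_real t))"
proof -
  have "integrable M (\<lambda>t. coeff f k * complex_of_real t ^ k)" for k
    using integrable_of_real[OF assms[of k], where 'a = complex]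
    by (simp add: integrable_mult_right)
  then show ?thesis
    unfolding poly_altdef by (intro Bochner_Integration.integrable_sum)
qed

text \<open>On the real line the conjugate of a value of \<open>g\<close> is a value of the
  polynomial with conjugated coefficients, so the integrand is itself a polynomial in
  \<open>t\<close>.\<close>

lemma integrable_poly_pairing:
  assumes "\<And>k. integrable M (\<lambda>t :: real. t ^ k)"
  shows "integrable M (\<lambda>t. poly f (complex_of_real t) * cnj (poly g (complex_of_real t)))"
proof -
  have "poly (f * map_poly cnj g) (complex_of_real t) =
      poly f (complex_of_real t) * cnj (poly g (complex_of_real t))" for t
    using poly_cnj[of g "complex_of_real t"] by simp
  with integrable_poly_of_real[OF assms, of "f * map_poly cnj g"] show ?thesis
    by simp
qed

lemma
  assumes "finite_moments \<mu>"
  shows poly_pairing_sum_left: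
      "poly_pairing \<mu> (\<Sum>l\<in>I. smult (a l) (f l)) g = (\<Sum>l\<in>I. a l * poly_pairing \<mu> (f l) g)"
    and poly_pairing_sum_right:
      "poly_pairing \<mu> g (\<Sum>l\<in>I. smult (a l) (f l)) = (\<Sum>l\<in>I. cnj (a l) * poly_pairing \<mu> g (f l))"
proof -
  have int: "integrable (pos_variation \<mu>) (\<lambda>t. poly f (complex_of_real t) * cnj (poly g (complex_of_real t)))"
      "integrable (neg_variation \<mu>) (\<lambda>t. poly f (complex_of_real t) * cnj (poly g (complex_of_real t)))" for f g
    using assms unfolding finite_moments_def by (auto intro!: integrable_poly_pairing)
  show "poly_pairing \<mu> (\<Sum>l\<in>I. smult (a l) (f l)) g = (\<Sum>l\<in>I. a l * poly_pairing \<mu> (f l) g)"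
    unfolding poly_pairing_def signed_integral_def
    by (simp add: poly_sum sum_distrib_right mult.assoc int right_diff_distrib sum_subtractf)
  show "poly_pairing \<mu> g (\<Sum>l\<in>I. smult (a l) (f l)) = (\<Sum>l\<in>I. cnj (a l) * poly_pairing \<mu> g (f l))"
    unfolding poly_pairing_def signed_integral_def
    by (simp add: poly_sum sum_distrib_left mult.left_commute int right_diff_distrib sum_subtractf)
qed

text \<open>Subtracting the multiple of \<open>P n\<close> that cancels the top coefficient lowers
  the degree. The value of \<open>a n\<close> is recorded because these quotients become the factors
  of \<open>C_const\<close>.\<close>

lemma poly_sequence_expansion:
  assumes P: "poly_sequence P" and "degree q \<le> n"
  obtains a where "q = (\<Sum>l\<le>n. smult (a l) (P l))" "a n = coeff q n / coeff (P n) n"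
  using assms(2)
proof (induction n arbitrary: q thesis)
  case 0
  from P have nz: "coeff (P 0) 0 \<noteq> 0" and "degree (P 0) = 0"
    by (metis leading_coeff_0_iff poly_sequence_def)+
  moreover have "q = smult (coeff q 0 / coeff (P 0) 0) (P 0)"
    using 0 nz \<open>degree (P 0) = 0\<close> by (auto elim!: degree_eq_zeroE)
  ultimately show ?case
    using 0(1)[of "\<lambda>_. coeff q 0 / coeff (P 0) 0"] by simp
next
  case (Suc n)
  let ?c = "coeff q (Suc n) / coeff (P (Suc n)) (Suc n)"
  from P have deg: "degree (P (Suc n)) = Suc n" and nz: "coeff (P (Suc n)) (Suc n) \<noteq> 0"
    by (metis leading_coeff_0_iff poly_sequence_def)+
  have "degree (q - smult ?c (P (Suc n))) \<le> n"
  proof (rule degree_le, intro allI impI)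
    fix i assume "n < i"
    then consider "i = Suc n" | "i > Suc n" by linarith
    then show "coeff (q - smult ?c (P (Suc n))) i = 0"
      using nz deg Suc.prems(2) by cases (auto simp: coeff_eq_0)
  qed
  then obtain a where "q - smult ?c (P (Suc n)) = (\<Sum>l\<le>n. smult (a l) (P l))"
    using Suc.IH by metis
  then have "q = (\<Sum>l\<le>n. smult (a l) (P l)) + smult ?c (P (Suc n))"
    by (simp add: algebra_simps)
  then show ?case
    using Suc.prems(1)[of "a(Suc n := ?c)"] by simp
qed

text \<open>Orthogonality passes from the \<open>p l\<close> with \<open>l < k\<close> to their
  span, which contains every polynomial of degree below \<open>k\<close>; it is applied to the
  \<open>\<psi> j\<close>.\<close>

lemma orthogonal_polys_pairing_eq_0:
  assumes "finite_moments \<mu>" "orthogonal_polys \<mu> p" "degree q < k"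
  shows "poly_pairing \<mu> (p k) q = 0"
proof -
  obtain a where "q = (\<Sum>l\<le>degree q. smult (a l) (p l))"
    using poly_sequence_expansion[of p q "degree q"] assms(2) unfolding orthogonal_polys_def
    by blast
  then have "poly_pairing \<mu> (p k) q = (\<Sum>l\<le>degree q. cnj (a l) * poly_pairing \<mu> (p k) (p l))"
    using poly_pairing_sum_right[OF assms(1)] by metis
  also have "\<dots> = 0"
    using assms(2,3) by (intro sum.neutral) (auto simp: orthogonal_polys_def)
  finally show ?thesis .
qed

lemma funpow_lowering:
  assumes lin: "Vector_Spaces.linear smult smult T"
    and T: "lowers_degree_by_one T" "r 0 = 1" "\<And>k. k \<ge> 1 \<Longrightarrow> T (r k) = r (k - 1)"
  shows "(T ^^ i) (\<Sum>l\<in>I. smult (a l) (r l)) = (\<Sum>l\<in>I. smult (a l) (if i \<le> l then r (l - i) else 0))"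
proof (induction i)
  case (Suc i)
  interpret Vector_Spaces.linear smult smult T by fact
  \<comment> \<open>The boundary case is \<open>l = i\<close>: there \<open>r 0 = 1\<close> is a
    constant and is annihilated.\<close>
  have "T (if i \<le> l then r (l - i) else 0) = (if Suc i \<le> l then r (l - Suc i) else 0)" for l
    using T by (cases "i = l") (auto simp: lowers_degree_by_one_def zero)
  then show ?case
    using Suc by (simp add: sum scale)
qed simp

section \<open>Determinants of exchange and Toeplitz matrices\<close>

lemma det_exchange_mat:
  "det (mat m m (\<lambda>(i, j). if Suc (i + j) = m then 1 else 0)) = ((-1) ^ (m choose 2) :: 'a :: idom)"
proof (induction m)
  case (Suc m)
  let ?J = "\<lambda>m. mat m m (\<lambda>(i, j). if Suc (i + j) = m then 1 else 0) :: 'a mat"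
  \<comment> \<open>Moving the last row to the top past \<open>m\<close> rows splits off a block
    \<open>1\<close>.\<close>
  have "det (?J (Suc m)) = (-1) ^ m * det (four_block_mat (1\<^sub>m 1) (0\<^sub>m 1 m) (0\<^sub>m m 1) (?J m))"
    by (subst det_swap_rows[of _ m 1])
      (auto intro!: arg_cong[where f = det] arg_cong[where f = "(*) _"] eq_matI)
  also have "\<dots> = (-1) ^ m * det (?J m)"
    by (subst det_four_block_mat_upper_right_zero[of _ 1 _ m]) auto
  also have "\<dots> = (-1) ^ (Suc m choose 2)"
    by (simp add: Suc numeral_2_eq_2 power_add)
  finally show ?case .
qed (simp add: binomial_eq_0)

text \<open>Left multiplication by the exchange matrix reverses the rows. This accounts for the sign
  \<open>(-1) ^ (m choose 2)\<close>, since the rows of \<open>Omega_const\<close> run through the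
  moments downwards.\<close>

lemma det_reverse_rows:
  "det (mat m m (\<lambda>(i, j). f (m - (i + 1)) j)) =
    (-1) ^ (m choose 2) * det (mat m m (\<lambda>(i, j). f i j :: 'a :: idom))"
proof -
  let ?J = "mat m m (\<lambda>(i, j). if Suc (i + j) = m then 1 else 0) :: 'a mat"
  let ?A = "mat m m (\<lambda>(i, j). f i j)"
  have "mat m m (\<lambda>(i, j). f (m - (i + 1)) j) = ?J * ?A"
  proof (rule eq_matI)
    fix i j assume "i < dim_row (?J * ?A)" "j < dim_col (?J * ?A)"
    then have i: "i < m" and j: "j < m" by auto
    then have "(?J * ?A) $$ (i, j) = (\<Sum>k = 0..<m. (if Suc (i + k) = m then 1 else 0) * f k j)"
      by (simp add: scalar_prod_def)
    also have "\<dots> = (\<Sum>k = 0..<m. if k = m - (i + 1) then f k j else 0)"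
      using i by (intro sum.cong) auto
    also have "\<dots> = f (m - (i + 1)) j"
      using i by simp
    finally show "mat m m (\<lambda>(i, j). f (m - (i + 1)) j) $$ (i, j) = (?J * ?A) $$ (i, j)"
      using i j by simp
  qed auto
  then show ?thesis
    by (simp add: det_mult[of _ m] det_exchange_mat)
qed

text \<open>Lower triangular Toeplitz matrices multiply like power series in their first columns,
  and the hypothesis makes the two series inverse to each other.\<close>

lemma toeplitz_inverse_entry:
  fixes \<rho> \<sigma> :: "nat \<Rightarrow> 'a :: idom"
  assumes "\<And>k. (\<Sum>j\<le>k. \<sigma> j * \<rho> (k - j)) = (if k = 0 then 1 else 0)" and "i < N"
  shows "(\<Sum>l = 0..<N. (if l \<le> i then \<sigma> (i - l) else 0) * (if j \<le> l then \<rho> (l - j) else 0)) =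
    (if i = j then 1 else 0)"
proof -
  have "(\<Sum>l = 0..<N. (if l \<le> i then \<sigma> (i - l) else 0) * (if j \<le> l then \<rho> (l - j) else 0)) =
      (\<Sum>l\<in>{j..i}. \<sigma> (i - l) * \<rho> (l - j))"
    using assms(2) by (intro sum.mono_neutral_cong_right) auto
  also have "\<dots> = (if i = j then 1 else 0)"
  proof (cases "j \<le> i")
    case True
    have "(\<Sum>l\<in>{j..i}. \<sigma> (i - l) * \<rho> (l - j)) = (\<Sum>k\<le>i - j. \<sigma> k * \<rho> (i - j - k))"
      using True by (intro sum.reindex_bij_witness[of _ "\<lambda>k. i - k" "\<lambda>l. i - l"]) auto
    with assms(1)[of "i - j"] True show ?thesis by auto
  qed auto
  finally show ?thesis .
qed

text \<open>The purely algebraic core: \<open>\<rho>\<close> and \<open>\<sigma>\<close> stand for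
  the values of the \<open>r k\<close> and \<open>s k\<close> at \<open>x\<close>, \<open>a\<close>
  for the expansion coefficients, and \<open>\<mu>\<close> for the moments with the index of
  \<open>r\<close> first.\<close>

lemma det_toeplitz_duality:
  fixes \<rho> \<sigma> :: "nat \<Rightarrow> 'a :: idom" and a \<mu> :: "nat \<Rightarrow> nat \<Rightarrow> 'a"
  assumes inv: "\<And>k. (\<Sum>j\<le>k. \<sigma> j * \<rho> (k - j)) = (if k = 0 then 1 else 0)"
    and \<sigma>0: "\<sigma> 0 = 1"
    and tri: "\<And>i l. l > m + i \<Longrightarrow> a i l = 0"
    and orth: "\<And>i j. i < n \<Longrightarrow> j < m \<Longrightarrow> (\<Sum>l<m + n. a i l * \<mu> l j) = 0"
  shows "det (mat m m (\<lambda>(i, j). \<mu> i j)) *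
      det (mat n n (\<lambda>(i, j). \<Sum>l<m + n. a i l * (if j \<le> l then \<rho> (l - j) else 0))) =
    (-1) ^ (m * n) * (\<Prod>i<n. a i (m + i)) *
      det (mat m m (\<lambda>(i, j). \<Sum>l\<le>n + i. \<mu> l j * \<sigma> (n + i - l)))"
    (is "det ?M * det ?PR = _ * det ?Q")
proof -
  define N where "N = m + n"
  let ?\<rho> = "\<lambda>l j. if j \<le> l then \<rho> (l - j) else 0"
  let ?\<sigma> = "\<lambda>i l. if l \<le> i then \<sigma> (i - l) else 0"
  define X where "X = mat N N (\<lambda>(i, l). if i < m then if i = l then 1 else 0 else a (i - m) l)"
  define Y where "Y = mat N N (\<lambda>(l, j). if j < m then \<mu> l j else ?\<rho> l (j - m))"
  define S where "S = mat N N (\<lambda>(i, l). ?\<sigma> i l)"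
  have carrier: "X \<in> carrier_mat N N" "Y \<in> carrier_mat N N" "S \<in> carrier_mat N N"
    by (simp_all add: X_def Y_def S_def)

  have "X * Y = four_block_mat ?M (mat m n (\<lambda>(l, j). ?\<rho> l j)) (0\<^sub>m n m) ?PR"
  proof (rule eq_matI)
    fix i j
    assume "i < dim_row (four_block_mat ?M (mat m n (\<lambda>(l, j). ?\<rho> l j)) (0\<^sub>m n m) ?PR)"
      and "j < dim_col (four_block_mat ?M (mat m n (\<lambda>(l, j). ?\<rho> l j)) (0\<^sub>m n m) ?PR)"
    then have i: "i < N" and j: "j < N" by (auto simp: N_def)
    then have eq: "(X * Y) $$ (i, j) = (\<Sum>l<N. X $$ (i, l) * Y $$ (l, j))"
      using carrier by (simp add: scalar_prod_def lessThan_atLeast0)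
    show "(X * Y) $$ (i, j) = four_block_mat ?M (mat m n (\<lambda>(l, j). ?\<rho> l j)) (0\<^sub>m n m) ?PR $$ (i, j)"
    proof (cases "i < m")
      case True
      have "(X * Y) $$ (i, j) = (\<Sum>l<N. if i = l then Y $$ (l, j) else 0)"
        unfolding eq using True i by (intro sum.cong) (auto simp: X_def)
      also have "\<dots> = Y $$ (i, j)"
        using i by simp
      finally show ?thesis
        using True i j by (auto simp: Y_def N_def)
    next
      case False
      have "(X * Y) $$ (i, j) = (\<Sum>l<N. a (i - m) l * (if j < m then \<mu> l j else ?\<rho> l (j - m)))"
        unfolding eq using False i j by (intro sum.cong) (auto simp: X_def Y_def)
      then show ?thesis
        using False i j orth[of "i - m" j] by (cases "j < m") (auto simp: N_def)
    qed
  qed (auto simp: X_def Y_def N_def)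
  then have detXY: "det X * det Y = det ?M * det ?PR"
    using carrier
    by (simp add: det_mult[of X N Y, symmetric] det_four_block_mat_lower_left_zero[of _ m _ n])

  \<comment> \<open>By \<open>tri\<close>, row \<open>i - m\<close> of \<open>a\<close> ends at
    column \<open>i\<close>, so \<open>X\<close> is lower triangular.\<close>
  have "det X = (\<Prod>i = 0..<m + n. if i < m then 1 else a (i - m) i)"
    using tri by (subst det_lower_triangular[OF _ carrier(1)])
      (auto simp: X_def N_def prod_list_diag_prod intro!: prod.cong)
  also have "\<dots> = (\<Prod>i\<in>{m..<m + n}. a (i - m) i)"
    by (intro prod.mono_neutral_cong_right) auto
  also have "\<dots> = (\<Prod>i<n. a i (m + i))"
    by (intro prod.reindex_bij_witness[of _ "\<lambda>i. m + i" "\<lambda>i. i - m"]) auto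
  finally have detX: "det X = (\<Prod>i<n. a i (m + i))" .

  have detS: "det S = 1"
    using \<sigma>0 by (subst det_lower_triangular[OF _ carrier(3)])
      (auto simp: S_def prod_list_diag_prod)
  have SY: "(S * Y) $$ (i, j) =
      (if j < m then \<Sum>l\<le>i. \<mu> l j * \<sigma> (i - l) else if i = j - m then 1 else 0)"
    if i: "i < N" and j: "j < N" for i j
  proof -
    have "(S * Y) $$ (i, j) = (\<Sum>l = 0..<N. ?\<sigma> i l * (if j < m then \<mu> l j else ?\<rho> l (j - m)))"
      using i j by (auto simp: scalar_prod_def S_def Y_def intro!: sum.cong)
    moreover have "(\<Sum>l = 0..<N. ?\<sigma> i l * \<mu> l j) = (\<Sum>l\<le>i. \<mu> l j * \<sigma> (i - l))"
      using i by (intro sum.mono_neutral_cong_right) auto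
    ultimately show ?thesis
      using toeplitz_inverse_entry[of \<sigma> \<rho> i N "j - m", OF inv i] by auto
  qed
  \<comment> \<open>Moving the \<open>n\<close> Toeplitz columns in front of the \<open>m\<close>
    moment columns puts the identity in the upper left corner; the rows from \<open>n\<close> on
    then leave \<open>?Q\<close>.\<close>
  have "det (S * Y) = (-1) ^ (n * m) *
      det (mat (n + m) (n + m) (\<lambda>(i, j). (S * Y) $$ (i, if j < n then j + m else j - n)))"
    using carrier by (intro det_swap_cols) (auto simp: N_def)
  also have "mat (n + m) (n + m) (\<lambda>(i, j). (S * Y) $$ (i, if j < n then j + m else j - n)) =
      four_block_mat (1\<^sub>m n) (mat n m (\<lambda>(i, j). \<Sum>l\<le>i. \<mu> l j * \<sigma> (i - l))) (0\<^sub>m m n) ?Q"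
    by (rule eq_matI) (auto simp: SY N_def)
  also have "det \<dots> = det ?Q"
    by (subst det_four_block_mat_lower_left_zero[of _ n _ m]) auto
  finally have "det Y = (-1) ^ (m * n) * det ?Q"
    using carrier detS by (simp add: det_mult[of S N Y] mult.commute)
  with detXY detX show ?thesis
    by (simp add: mult.assoc mult.left_commute)
qed

theorem theorem1p2:
  fixes T :: "complex poly \<Rightarrow> complex poly"
    and r s p \<psi> :: "nat \<Rightarrow> complex poly"
    and \<mu> :: "real set \<Rightarrow> real"
    and n m :: nat
    and x :: complex
  assumes "Vector_Spaces.linear smult smult T"
    and "lowers_degree_by_one T"
    and "poly_sequence r"
    and "r 0 = 1"
    and "\<And>k. k \<ge> 1 \<Longrightarrow> T (r k) = r (k - 1)"
    and "s 0 = 1"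
    and "\<And>k. k \<ge> 1 \<Longrightarrow> (\<Sum>j\<le>k. s j * r (k - j)) = 0"
    and "signed_measure \<mu>"
    and "finite_moments \<mu>"
    and "orthogonal_polys \<mu> p"
    and "poly_sequence \<psi>"
    and "n \<ge> 1"
    and "m \<ge> 1"
  shows "Omega_const \<mu> r \<psi> m * det (mat n n (\<lambda>(i, j). poly ((T ^^ i) (p (m + j))) x)) =
         C_const p r n m * det (mat m m (\<lambda>(i, j). poly (q_poly \<mu> r \<psi> s (n + i) j) x))"
proof -
  have "\<exists>a. (\<forall>l>m + i. a l = 0) \<and> p (m + i) = (\<Sum>l\<le>m + i. smult (a l) (r l)) \<and>
      a (m + i) = coeff (p (m + i)) (m + i) / coeff (r (m + i)) (m + i)" for i
  proof -
    have "degree (p (m + i)) \<le> m + i"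
      using assms(10) by (simp add: orthogonal_polys_def poly_sequence_def)
    then obtain a where "p (m + i) = (\<Sum>l\<le>m + i. smult (a l) (r l))"
        "a (m + i) = coeff (p (m + i)) (m + i) / coeff (r (m + i)) (m + i)"
      using poly_sequence_expansion[OF assms(3)] by metis
    then show ?thesis
      \<comment> \<open>Coefficients beyond \<open>m + i\<close> are set to zero, so that all
        \<open>p (m + i)\<close> with \<open>i < n\<close> can be summed over the common range
        \<open>l < m + n\<close>.\<close>
      by (intro exI[of _ "\<lambda>l. if l \<le> m + i then a l else 0"]) (auto intro!: sum.cong)
  qed
  then obtain a where tri: "\<And>i l. l > m + i \<Longrightarrow> a i l = 0"
    and p: "\<And>i. p (m + i) = (\<Sum>l\<le>m + i. smult (a i l) (r l))"
    and lead: "\<And>i. a i (m + i) = coeff (p (m + i)) (m + i) / coeff (r (m + i)) (m + i)"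
    by metis
  have p_sum: "p (m + i) = (\<Sum>l<m + n. smult (a i l) (r l))" if "i < n" for i
    unfolding p using that tri by (intro sum.mono_neutral_left) auto
  let ?\<mu> = "\<lambda>l j. mixed_moment \<mu> r \<psi> j l"
  let ?T = "mat n n (\<lambda>(i, j). poly ((T ^^ i) (p (m + j))) x)"

  have inv: "(\<Sum>j\<le>k. poly (s j) x * poly (r (k - j)) x) = (if k = 0 then 1 else 0)" for k
  proof (cases "k = 0")
    case False
    then have "poly (\<Sum>j\<le>k. s j * r (k - j)) x = 0"
      using assms(7) by simp
    with False show ?thesis by (simp add: poly_sum)
  qed (simp add: assms(4,6))
  have orth: "(\<Sum>l<m + n. a i l * ?\<mu> l j) = 0" if "i < n" "j < m" for i j
  proof -
    \<comment> \<open>Here \<open>j < m\<close> is what puts the degree below that of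
      \<open>p (m + i)\<close>.\<close>
    have "degree (\<psi> j) < m + i"
      using assms(11) that by (simp add: poly_sequence_def)
    then have "poly_pairing \<mu> (p (m + i)) (\<psi> j) = 0"
      using orthogonal_polys_pairing_eq_0 assms(9,10) by blast
    then show ?thesis
      by (simp add: p_sum[OF that(1)] poly_pairing_sum_left[OF assms(9)] mixed_moment_def)
  qed
  have dual: "det (mat m m (\<lambda>(i, j). ?\<mu> i j)) *
      det (mat n n (\<lambda>(i, j). \<Sum>l<m + n. a i l * (if j \<le> l then poly (r (l - j)) x else 0))) =
    (-1) ^ (m * n) * (\<Prod>i<n. a i (m + i)) *
      det (mat m m (\<lambda>(i, j). \<Sum>l\<le>n + i. ?\<mu> l j * poly (s (n + i - l)) x))"
    using inv tri orth assms(6) by (intro det_toeplitz_duality) auto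

  \<comment> \<open>In the theorem the power of \<open>T\<close> indexes rows; in the duality it
    indexes columns.\<close>
  have "transpose_mat ?T =
      mat n n (\<lambda>(i, j). \<Sum>l<m + n. a i l * (if j \<le> l then poly (r (l - j)) x else 0))"
    by (rule eq_matI)
      (auto simp: p_sum funpow_lowering[OF assms(1,2,4,5)] poly_sum intro!: sum.cong)
  then have "det (mat n n (\<lambda>(i, j). \<Sum>l<m + n. a i l * (if j \<le> l then poly (r (l - j)) x else 0))) =
      det ?T"
    using det_transpose[of ?T n] by simp
  moreover have "mat m m (\<lambda>(i, j). poly (q_poly \<mu> r \<psi> s (n + i) j) x) =
      mat m m (\<lambda>(i, j). \<Sum>l\<le>n + i. ?\<mu> l j * poly (s (n + i - l)) x)"
    by (simp add: q_poly_def poly_sum)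
  moreover have "Omega_const \<mu> r \<psi> m = (-1) ^ (m choose 2) * det (mat m m (\<lambda>(i, j). ?\<mu> i j))"
    unfolding Omega_const_def using det_reverse_rows[of m ?\<mu>] by simp
  ultimately show ?thesis
    using dual by (simp add: C_const_def lead power_add mult.assoc mult.left_commute)
qed

end
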